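(* Let $u$ and $v$ satisfy the non-dimensional reaction-diffusion system with activator-depleted reaction kinetics $$\frac{\partial u}{\partial t}=\triangle_p u+\gamma(\alpha-u+u^2v),\qquad \frac{\partial v}{\partial t}=d\,\triangle_p v+\gamma(\beta-u^2v),$$ with homogeneous Neumann boundary conditions $\frac{\partial u}{\partial r}\big|_{r=\rho}=\frac{\partial v}{\partial r}\big|_{r=\rho}=0$, on a disk-shape domain $\Omega\subset\mathbb{R}^2$ with radius $\rho$ and positive real parameters $\gamma$, $d$, $\alpha$ and $\beta$. Given that the radius $\rho$ of $\Omega$ satisfies the inequality $$\rho<2\sqrt{\frac{(d+1)(2k+1)(n+2k+1)(n+4k)}{\gamma(n+4k+2)}},$$ where $n\in\mathbb{R}\setminus\frac12\mathbb{Z}$ is the associated order of the Bessel equations and $k$ is any positive integer, then for all $\alpha,\beta\in\mathbb{R}_+$, in the neighbourhood of the unique steady state $(u_s,v_s)=\big(\alpha+\beta,\frac{\beta}{(\alpha+\beta)^2}\big)$, the diffusion-driven instability of the system is restricted to Turing type only, forbidding the existence of Hopf and transcritical bifurcations.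
   Context: $\Omega$ is the disk $\{x^2+y^2<\rho^2\}$ with polar coordinates $(r,\theta)$, and $\triangle_p=\frac1r\frac{\partial}{\partial r}\big(r\frac{\partial}{\partial r}\big)+\frac1{r^2}\frac{\partial^2}{\partial\theta^2}$ is the Laplace operator in polar coordinates. The system is supplemented with initial data $u_0,v_0$ that are positive bounded continuous functions. The paper takes the eigenvalues of $-\triangle_p$ with homogeneous Neumann conditions to be $$\eta_{n,k}^2=\frac{4(2k+1)(n+2k+1)(n+4k)}{\rho^2(n+4k+2)},$$ where $n\in\mathbb{R}\setminus\frac12\mathbb{Z}$ is the order of the associated Bessel equation and $k$ is the mode index. Linearising the system about $(u_s,v_s)$, with solutions expanded in the eigenfunctions, gives the stability matrix $$\begin{pmatrix}\gamma\frac{\beta-\alpha}{\beta+\alpha}-\eta_{n,k}^2 & \gamma(\beta+\alpha)^2\\[2pt] -\gamma\frac{2\beta}{\beta+\alpha} & -\gamma(\beta+\alpha)^2-d\,\eta_{n,k}^2\end{pmatrix},$$ with eigenvalues $\sigma_{1,2}$. Terminology: Turing instability is instability concerning space and not time, corresponding to $\sigma_{1,2}$ real with at least one of them positive. The system undergoes Hopf bifurcation if its dynamics become unstable along the time axis and exhibit temporal periodicity, corresponding to $\sigma_{1,2}\in\mathbb{C}\setminus\mathbb{R}$ with $\mathrm{Re}(\sigma_{1,2})>0$. It undergoes transcritical bifurcation (in the paper's usage) if it exhibits oscillations with orbital periodicity, corresponding to $\sigma_{1,2}\in\mathbb{C}\setminus\mathbb{R}$ with $\mathrm{Re}(\sigma_{1,2})=0$.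 *)

theory Defs
  imports "HOL-Analysis.Analysis" "Jordan_Normal_Form.Spectral_Radius"
begin

definition disk :: "real \<Rightarrow> (real \<times> real) set" where
  "disk \<rho> = {(x, y). x\<^sup>2 + y\<^sup>2 < \<rho>\<^sup>2}"

definition in_polar :: "(real \<times> real \<Rightarrow> real) \<Rightarrow> real \<Rightarrow> real \<Rightarrow> real" where
  "in_polar w r \<theta> = w (r * cos \<theta>, r * sin \<theta>)"

definition polar_laplacian :: "(real \<Rightarrow> real \<Rightarrow> real) \<Rightarrow> real \<Rightarrow> real \<Rightarrow> real" where
  "polar_laplacian w r \<theta> =
     1 / r * deriv (\<lambda>s. s * deriv (\<lambda>s'. w s' \<theta>) s) r
     + 1 / r\<^sup>2 * deriv (\<lambda>\<phi>. deriv (\<lambda>\<phi>'. w r \<phi>') \<phi>) \<theta>"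

text \<open>\<^const>\<open>deriv\<close> is a total operator; the next predicate guarantees that every derivative
  occurring in \<^const>\<open>polar_laplacian\<close> exists.  The coordinate singularity \<open>r = 0\<close> is excluded.\<close>

definition twice_diff_polar :: "real \<Rightarrow> (real \<Rightarrow> real \<Rightarrow> real) \<Rightarrow> bool" where
  "twice_diff_polar \<rho> w \<longleftrightarrow> (\<forall>r \<theta>. 0 < r \<and> r < \<rho> \<longrightarrow>
     (\<lambda>s. w s \<theta>) differentiable (at r) \<and>
     (\<lambda>s. deriv (\<lambda>s'. w s' \<theta>) s) differentiable (at r) \<and>
     (\<lambda>\<phi>. w r \<phi>) differentiable (at \<theta>) \<and>
     (\<lambda>\<phi>. deriv (\<lambda>\<phi>'. w r \<phi>') \<phi>) differentiable (at \<theta>))"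

definition kinetics_u :: "real \<Rightarrow> real \<Rightarrow> real \<Rightarrow> real \<Rightarrow> real" where
  "kinetics_u \<gamma> \<alpha> u v = \<gamma> * (\<alpha> - u + u\<^sup>2 * v)"

definition kinetics_v :: "real \<Rightarrow> real \<Rightarrow> real \<Rightarrow> real \<Rightarrow> real" where
  "kinetics_v \<gamma> \<beta> u v = \<gamma> * (\<beta> - u\<^sup>2 * v)"

text \<open>Classical solutions for all times \<open>t > 0\<close>.  The first argument of \<open>u\<close> and \<open>v\<close> is time,
  the second a Cartesian point of the closed disk.  At \<open>r = \<rho>\<close> the radial derivative is taken
  from inside the disk.\<close>

definition solves_rd_system ::
  "real \<Rightarrow> real \<Rightarrow> real \<Rightarrow> real \<Rightarrow> real \<Rightarrow>
   (real \<Rightarrow> real \<times> real \<Rightarrow> real) \<Rightarrow> (real \<Rightarrow> real \<times> real \<Rightarrow> real) \<Rightarrow> bool" where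
  "solves_rd_system \<gamma> d \<alpha> \<beta> \<rho> u v \<longleftrightarrow>
     continuous_on ({0..} \<times> disk \<rho>) (\<lambda>(t, x). u t x) \<and>
     continuous_on ({0..} \<times> disk \<rho>) (\<lambda>(t, x). v t x) \<and>
     (\<forall>t>0. twice_diff_polar \<rho> (in_polar (u t)) \<and> twice_diff_polar \<rho> (in_polar (v t))) \<and>
     (\<forall>t>0. \<forall>r \<theta>. 0 < r \<and> r < \<rho> \<longrightarrow>
        ((\<lambda>\<tau>. in_polar (u \<tau>) r \<theta>) has_real_derivative
           (polar_laplacian (in_polar (u t)) r \<theta>
            + kinetics_u \<gamma> \<alpha> (in_polar (u t) r \<theta>) (in_polar (v t) r \<theta>))) (at t) \<and>
        ((\<lambda>\<tau>. in_polar (v \<tau>) r \<theta>) has_real_derivative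
           (d * polar_laplacian (in_polar (v t)) r \<theta>
            + kinetics_v \<gamma> \<beta> (in_polar (u t) r \<theta>) (in_polar (v t) r \<theta>))) (at t)) \<and>
     (\<forall>t>0. \<forall>\<theta>.
        ((\<lambda>r. in_polar (u t) r \<theta>) has_real_derivative 0) (at \<rho> within {0..\<rho>}) \<and>
        ((\<lambda>r. in_polar (v t) r \<theta>) has_real_derivative 0) (at \<rho> within {0..\<rho>}))"

definition admissible_initial_datum :: "real \<Rightarrow> (real \<times> real \<Rightarrow> real) \<Rightarrow> bool" where
  "admissible_initial_datum \<rho> w \<longleftrightarrow>
     (\<forall>x\<in>disk \<rho>. 0 < w x) \<and> bounded (w ` disk \<rho>) \<and> continuous_on (disk \<rho>) w"

text \<open>Steady states are spatially uniform: constants solving the full boundary value problem.\<close>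

definition uniform_steady_state ::
  "real \<Rightarrow> real \<Rightarrow> real \<Rightarrow> real \<Rightarrow> real \<Rightarrow> real \<times> real \<Rightarrow> bool" where
  "uniform_steady_state \<gamma> d \<alpha> \<beta> \<rho> p \<longleftrightarrow>
     solves_rd_system \<gamma> d \<alpha> \<beta> \<rho> (\<lambda>_ _. fst p) (\<lambda>_ _. snd p)"

definition u_s :: "real \<Rightarrow> real \<Rightarrow> real" where
  "u_s \<alpha> \<beta> = \<alpha> + \<beta>"

definition v_s :: "real \<Rightarrow> real \<Rightarrow> real" where
  "v_s \<alpha> \<beta> = \<beta> / (\<alpha> + \<beta>)\<^sup>2"

text \<open>\<open>eta_sq \<rho> n k\<close> is the eigenvalue written \<open>\<eta>\<^sup>2\<close> with indices \<open>n, k\<close>; it is a single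
  quantity, not the square of a given real number.  The closed formula is taken as the definition;
  it is not derived here from the Neumann problem for \<^const>\<open>polar_laplacian\<close>.\<close>

definition eta_sq :: "real \<Rightarrow> real \<Rightarrow> nat \<Rightarrow> real" where
  "eta_sq \<rho> n k =
     4 * (2 * real k + 1) * (n + 2 * real k + 1) * (n + 4 * real k)
       / (\<rho>\<^sup>2 * (n + 4 * real k + 2))"

text \<open>Linearisation at \<open>(u_s, v_s)\<close> restricted to an eigenmode of the negative Laplacian with
  eigenvalue \<open>\<eta>\<^sup>2\<close>: the Jacobian of the kinetics minus \<open>\<eta>\<^sup>2\<close> times the diffusion matrix.
  The entries are evaluated in lemma \<open>stability_matrix_eq\<close>.\<close>

definition stability_matrix ::
  "real \<Rightarrow> real \<Rightarrow> real \<Rightarrow> real \<Rightarrow> real \<Rightarrow> real \<Rightarrow> nat \<Rightarrow> complex mat" where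
  "stability_matrix \<gamma> d \<alpha> \<beta> \<rho> n k =
     mat_of_rows_list 2
       [[complex_of_real (deriv (\<lambda>u. kinetics_u \<gamma> \<alpha> u (v_s \<alpha> \<beta>)) (u_s \<alpha> \<beta>) - eta_sq \<rho> n k),
         complex_of_real (deriv (\<lambda>v. kinetics_u \<gamma> \<alpha> (u_s \<alpha> \<beta>) v) (v_s \<alpha> \<beta>))],
        [complex_of_real (deriv (\<lambda>u. kinetics_v \<gamma> \<beta> u (v_s \<alpha> \<beta>)) (u_s \<alpha> \<beta>)),
         complex_of_real (deriv (\<lambda>v. kinetics_v \<gamma> \<beta> (u_s \<alpha> \<beta>) v) (v_s \<alpha> \<beta>) - d * eta_sq \<rho> n k)]]"

lemma stability_matrix_eq:
  assumes "0 < \<alpha>" "0 < \<beta>"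
  shows "stability_matrix \<gamma> d \<alpha> \<beta> \<rho> n k =
     mat_of_rows_list 2
       [[complex_of_real (\<gamma> * ((\<beta> - \<alpha>) / (\<beta> + \<alpha>)) - eta_sq \<rho> n k),
         complex_of_real (\<gamma> * (\<beta> + \<alpha>)\<^sup>2)],
        [complex_of_real (- (\<gamma> * (2 * \<beta> / (\<beta> + \<alpha>)))),
         complex_of_real (- (\<gamma> * (\<beta> + \<alpha>)\<^sup>2) - d * eta_sq \<rho> n k)]]"
proof -
  have nz: "\<alpha> + \<beta> \<noteq> 0" using assms by simp
  have fu: "deriv (\<lambda>u. kinetics_u \<gamma> \<alpha> u (v_s \<alpha> \<beta>)) (u_s \<alpha> \<beta>) = \<gamma> * ((\<beta> - \<alpha>) / (\<beta> + \<alpha>))"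
    unfolding kinetics_u_def u_s_def v_s_def using nz
    by (intro DERIV_imp_deriv) (auto intro!: derivative_eq_intros simp: divide_simps power2_eq_square, (simp add: algebra_simps)?)
  have fv: "deriv (\<lambda>v. kinetics_u \<gamma> \<alpha> (u_s \<alpha> \<beta>) v) (v_s \<alpha> \<beta>) = \<gamma> * (\<beta> + \<alpha>)\<^sup>2"
    unfolding kinetics_u_def u_s_def v_s_def
    by (intro DERIV_imp_deriv) (auto intro!: derivative_eq_intros simp: add.commute)
  have gu: "deriv (\<lambda>u. kinetics_v \<gamma> \<beta> u (v_s \<alpha> \<beta>)) (u_s \<alpha> \<beta>) = - (\<gamma> * (2 * \<beta> / (\<beta> + \<alpha>)))"
    unfolding kinetics_v_def u_s_def v_s_def using nz
    by (intro DERIV_imp_deriv) (auto intro!: derivative_eq_intros simp: divide_simps power2_eq_square, (simp add: algebra_simps)?)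
  have gv: "deriv (\<lambda>v. kinetics_v \<gamma> \<beta> (u_s \<alpha> \<beta>) v) (v_s \<alpha> \<beta>) = - (\<gamma> * (\<beta> + \<alpha>)\<^sup>2)"
    unfolding kinetics_v_def u_s_def v_s_def
    by (intro DERIV_imp_deriv) (auto intro!: derivative_eq_intros simp: add.commute)
  show ?thesis unfolding stability_matrix_def fu fv gu gv ..
qed

text \<open>The spectrum below is the set of the eigenvalues \<open>\<sigma>\<^sub>1, \<sigma>\<^sub>2\<close> of a complex 2-by-2 matrix.
  It is nonempty, so the universal quantifiers are never vacuous.\<close>

definition linearly_unstable :: "complex mat \<Rightarrow> bool" where
  "linearly_unstable A \<longleftrightarrow> (\<exists>\<sigma>\<in>spectrum A. 0 < Re \<sigma>)"

definition turing_instability :: "complex mat \<Rightarrow> bool" where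
  "turing_instability A \<longleftrightarrow> (\<forall>\<sigma>\<in>spectrum A. \<sigma> \<in> \<real>) \<and> (\<exists>\<sigma>\<in>spectrum A. 0 < Re \<sigma>)"

definition hopf_bifurcation :: "complex mat \<Rightarrow> bool" where
  "hopf_bifurcation A \<longleftrightarrow> (\<forall>\<sigma>\<in>spectrum A. \<sigma> \<notin> \<real> \<and> 0 < Re \<sigma>)"

definition transcritical_bifurcation :: "complex mat \<Rightarrow> bool" where
  "transcritical_bifurcation A \<longleftrightarrow> (\<forall>\<sigma>\<in>spectrum A. \<sigma> \<notin> \<real> \<and> Re \<sigma> = 0)"

end

theory Submission
  imports Defs
begin

text \<open>The bound on \<open>\<rho>\<close> says exactly that \<open>\<gamma> < (d + 1) \<eta>\<^sup>2\<close>, which makes the trace of the stability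
  matrix negative for all positive \<open>\<alpha>\<close> and \<open>\<beta>\<close>. A non-real eigenvalue of a real 2-by-2 matrix has
  half the trace as its real part, so every eigenvalue in the closed right half plane is real.\<close>

lemma det_mat2:
  fixes A :: "'a :: comm_ring_1 mat"
  assumes A: "A \<in> carrier_mat 2 2"
  shows "Determinant.det A = A $$ (0, 0) * A $$ (1, 1) - A $$ (0, 1) * A $$ (1, 0)"
  using A by (subst laplace_expansion_row[OF A, of 0])
    (auto simp: cofactor_def det_single lessThan_nat_numeral lessThan_Suc mat_delete_def)

text \<open>The characteristic polynomial in trace-determinant form: what follows argues only about
  roots of a monic quadratic with real coefficients.\<close>

lemma spectrum_mat2:
  fixes a b c e :: complex
  shows "\<sigma> \<in> spectrum (mat_of_rows_list 2 [[a, b], [c, e]]) \<longleftrightarrow>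
    \<sigma>\<^sup>2 - (a + e) * \<sigma> + (a * e - b * c) = 0"
proof -
  let ?A = "mat_of_rows_list 2 [[a, b], [c, e]]"
  have A: "?A \<in> carrier_mat 2 2"
    by (auto simp: mat_of_rows_list_def)
  have "\<sigma> \<in> spectrum ?A \<longleftrightarrow> Determinant.det (char_matrix ?A \<sigma>) = 0"
    by (simp add: spectrum_def eigenvalue_det[OF A])
  also have "Determinant.det (char_matrix ?A \<sigma>) = (a - \<sigma>) * (e - \<sigma>) - b * c"
    using A by (subst det_mat2) (auto simp: char_matrix_def mat_of_rows_list_def)
  finally show ?thesis
    by (simp add: algebra_simps power2_eq_square)
qed

lemma spectrum_mat2_nonempty:
  fixes a b c e :: complex
  shows "spectrum (mat_of_rows_list 2 [[a, b], [c, e]]) \<noteq> {}"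
  by (rule spectrum_non_empty[where n = 2]) (auto simp: mat_of_rows_list_def)

text \<open>Since \<open>T\<close> and \<open>D\<close> are real, the imaginary part of the equation
  loses \<open>D\<close> and factors as \<open>Im \<sigma> * (2 * Re \<sigma> - T)\<close>, whose
  first factor is nonzero.\<close>

lemma Re_nonreal_root_monic_quadratic:
  fixes \<sigma> :: complex and T D :: real
  assumes "\<sigma>\<^sup>2 - of_real T * \<sigma> + of_real D = 0" and "\<sigma> \<notin> \<real>"
  shows "Re \<sigma> = T / 2"
proof -
  have "Im (\<sigma>\<^sup>2 - of_real T * \<sigma> + of_real D) = 0"
    using assms(1) by simp
  then have "Im \<sigma> * (2 * Re \<sigma> - T) = 0"
    by (simp add: power2_eq_square algebra_simps)
  moreover have "Im \<sigma> \<noteq> 0"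
    using assms(2) by (simp add: complex_is_Real_iff)
  ultimately show ?thesis by simp
qed

text \<open>Turing instability asks for the whole spectrum to be real, while instability supplies
  just one eigenvalue in the right half plane. The difference of the two equations factors, so
  \<tau> is either \<sigma> or the Vieta partner \<open>T - \<sigma>\<close>.\<close>

lemma monic_quadratic_other_root_real:
  fixes \<sigma> \<tau> :: complex and T D :: real
  assumes "\<sigma>\<^sup>2 - of_real T * \<sigma> + of_real D = 0" and "\<tau>\<^sup>2 - of_real T * \<tau> + of_real D = 0"
    and "\<sigma> \<in> \<real>"
  shows "\<tau> \<in> \<real>"
proof -
  have "(\<tau> - \<sigma>) * (\<tau> + \<sigma> - of_real T) =
      (\<tau>\<^sup>2 - of_real T * \<tau> + of_real D) - (\<sigma>\<^sup>2 - of_real T * \<sigma> + of_real D)"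
    by (simp add: algebra_simps power2_eq_square)
  then have "(\<tau> - \<sigma>) * (\<tau> + \<sigma> - of_real T) = 0"
    using assms(1,2) by simp
  then have "\<tau> = \<sigma> \<or> \<tau> = of_real T - \<sigma>"
    by (metis eq_iff_diff_eq_0 eq_diff_eq mult_eq_0_iff)
  then show ?thesis
    using assms(3) by auto
qed

lemma real_mat2_negative_trace_instability:
  fixes a b c e :: real
  defines "A \<equiv> mat_of_rows_list 2
    [[complex_of_real a, complex_of_real b], [complex_of_real c, complex_of_real e]]"
  assumes "a + e < 0"
  shows "linearly_unstable A \<longrightarrow> turing_instability A"
    and "\<not> hopf_bifurcation A" and "\<not> transcritical_bifurcation A"
proof -
  have root: "\<sigma>\<^sup>2 - of_real (a + e) * \<sigma> + of_real (a * e - b * c) = 0" if "\<sigma> \<in> spectrum A" for \<sigma>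
    using that unfolding A_def spectrum_mat2 by simp
  have real: "\<sigma> \<in> \<real>" if "\<sigma> \<in> spectrum A" "0 \<le> Re \<sigma>" for \<sigma>
    using Re_nonreal_root_monic_quadratic[OF root[OF that(1)]] that(2) assms(2) by fastforce
  \<comment> \<open>Both bifurcation predicates quantify universally over the spectrum, so refuting
    them takes an actual eigenvalue.\<close>
  obtain \<sigma> where \<sigma>: "\<sigma> \<in> spectrum A"
    using spectrum_mat2_nonempty unfolding A_def by blast
  show "\<not> hopf_bifurcation A" "\<not> transcritical_bifurcation A"
    using \<sigma> real[OF \<sigma>] unfolding hopf_bifurcation_def transcritical_bifurcation_def
    by (metis less_imp_le order_refl)+
  show "linearly_unstable A \<longrightarrow> turing_instability A"
    unfolding linearly_unstable_def turing_instability_def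
    using real monic_quadratic_other_root_real root by (meson less_imp_le)
qed

text \<open>On constants the Laplacian, the time derivatives and the boundary derivatives all
  vanish, which leaves only the reaction terms.\<close>

lemma uniform_steady_state_iff_kinetics_zero:
  assumes "0 < \<rho>"
  shows "uniform_steady_state \<gamma> d \<alpha> \<beta> \<rho> (a, b) \<longleftrightarrow>
    kinetics_u \<gamma> \<alpha> a b = 0 \<and> kinetics_v \<gamma> \<beta> a b = 0"
proof
  assume "uniform_steady_state \<gamma> d \<alpha> \<beta> \<rho> (a, b)"
  \<comment> \<open>The equations are imposed only for radii strictly between 0 and \<rho>, so they
    are read off at some interior radius and at the sample time 1.\<close>
  moreover obtain r where "0 < r" "r < \<rho>"
    using dense[OF assms] by blast
  ultimately have "((\<lambda>\<tau>. a) has_real_derivative kinetics_u \<gamma> \<alpha> a b) (at 1) \<and>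
      ((\<lambda>\<tau>. b) has_real_derivative kinetics_v \<gamma> \<beta> a b) (at 1)"
    unfolding uniform_steady_state_def solves_rd_system_def
    by (auto simp: in_polar_def polar_laplacian_def dest!: spec[of _ "1 :: real"])
  then show "kinetics_u \<gamma> \<alpha> a b = 0 \<and> kinetics_v \<gamma> \<beta> a b = 0"
    using DERIV_unique DERIV_const by blast
next
  assume "kinetics_u \<gamma> \<alpha> a b = 0 \<and> kinetics_v \<gamma> \<beta> a b = 0"
  then show "uniform_steady_state \<gamma> d \<alpha> \<beta> \<rho> (a, b)"
    unfolding uniform_steady_state_def solves_rd_system_def
    by (simp add: in_polar_def[abs_def] polar_laplacian_def twice_diff_polar_def split_def)
qed

text \<open>Adding the two reaction terms cancels \<open>a\<^sup>2 * b\<close> and forces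
  \<open>a = \<alpha> + \<beta>\<close>; the second one then determines \<open>b\<close> after
  division by \<open>a\<^sup>2\<close>.\<close>

lemma kinetics_zero_iff:
  assumes "\<gamma> \<noteq> 0" and "\<alpha> + \<beta> \<noteq> 0"
  shows "kinetics_u \<gamma> \<alpha> a b = 0 \<and> kinetics_v \<gamma> \<beta> a b = 0 \<longleftrightarrow> a = u_s \<alpha> \<beta> \<and> b = v_s \<alpha> \<beta>"
proof -
  have "kinetics_u \<gamma> \<alpha> a b = 0 \<and> kinetics_v \<gamma> \<beta> a b = 0 \<longleftrightarrow> a = \<alpha> + \<beta> \<and> a\<^sup>2 * b = \<beta>"
    using assms(1) by (auto simp: kinetics_u_def kinetics_v_def)
  also have "\<dots> \<longleftrightarrow> a = u_s \<alpha> \<beta> \<and> b = v_s \<alpha> \<beta>"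
    using assms(2) by (auto simp: u_s_def v_s_def field_simps)
  finally show ?thesis .
qed

lemma radius_bound_imp_eta_sq_bound:
  assumes "0 < \<gamma>" and "0 < \<rho>"
    and bound: "\<rho> < 2 * sqrt ((d + 1) * (2 * real k + 1) * (n + 2 * real k + 1) * (n + 4 * real k)
                         / (\<gamma> * (n + 4 * real k + 2)))"
  shows "\<gamma> < (d + 1) * eta_sq \<rho> n k"
proof -
  define F where "F = (2 * real k + 1) * (n + 2 * real k + 1) * (n + 4 * real k) / (n + 4 * real k + 2)"
  have "\<rho> / 2 < sqrt ((d + 1) * F / \<gamma>)"
    using bound by (simp add: F_def mult.assoc mult.commute[of \<gamma>])
  \<comment> \<open>As \<open>n\<close> is an arbitrary real, the sign of \<open>F\<close> is not
    known beforehand. Squaring therefore uses the contrapositive of \<open>real_le_lsqrt\<close>,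
    which asks only that \<open>\<rho> / 2\<close> be nonnegative.\<close>
  then have "(\<rho> / 2)\<^sup>2 < (d + 1) * F / \<gamma>"
    using real_le_lsqrt[of "\<rho> / 2" "(d + 1) * F / \<gamma>"] assms(2) by linarith
  then have "\<gamma> < (d + 1) * (4 * F / \<rho>\<^sup>2)"
    using assms(1,2) by (simp add: field_simps power2_eq_square)
  also have "4 * F / \<rho>\<^sup>2 = eta_sq \<rho> n k"
    by (simp add: F_def eta_sq_def mult.assoc mult.commute)
  finally show ?thesis .
qed

theorem theorem4p2:
  fixes \<gamma> d \<alpha> \<beta> \<rho> n :: real
    and k :: nat
    and u v :: "real \<Rightarrow> real \<times> real \<Rightarrow> real"
    and u0 v0 :: "real \<times> real \<Rightarrow> real"
  assumes "0 < \<gamma>" and "0 < d" and "0 < \<alpha>" and "0 < \<beta>" and "0 < \<rho>"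
    and "solves_rd_system \<gamma> d \<alpha> \<beta> \<rho> u v"
    and "admissible_initial_datum \<rho> u0" and "admissible_initial_datum \<rho> v0"
    and "\<forall>x\<in>disk \<rho>. u 0 x = u0 x" and "\<forall>x\<in>disk \<rho>. v 0 x = v0 x"
    and "n \<notin> {real_of_int m / 2 | m. True}"
    and "1 \<le> k"
    and "\<rho> < 2 * sqrt ((d + 1) * (2 * real k + 1) * (n + 2 * real k + 1) * (n + 4 * real k)
                         / (\<gamma> * (n + 4 * real k + 2)))"
  shows "(\<forall>p. uniform_steady_state \<gamma> d \<alpha> \<beta> \<rho> p \<longleftrightarrow> p = (u_s \<alpha> \<beta>, v_s \<alpha> \<beta>)) \<and>
    (linearly_unstable (stability_matrix \<gamma> d \<alpha> \<beta> \<rho> n k) \<longrightarrow>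
       turing_instability (stability_matrix \<gamma> d \<alpha> \<beta> \<rho> n k)) \<and>
    \<not> hopf_bifurcation (stability_matrix \<gamma> d \<alpha> \<beta> \<rho> n k) \<and>
    \<not> transcritical_bifurcation (stability_matrix \<gamma> d \<alpha> \<beta> \<rho> n k)"
proof -
  have steady: "uniform_steady_state \<gamma> d \<alpha> \<beta> \<rho> p \<longleftrightarrow> p = (u_s \<alpha> \<beta>, v_s \<alpha> \<beta>)" for p
    using uniform_steady_state_iff_kinetics_zero[OF assms(5)] kinetics_zero_iff[of \<gamma> \<alpha> \<beta>] assms(1,3,4)
    by (cases p) simp
  \<comment> \<open>The only kinetic term of the trace that can be positive stays below \<gamma>
    whatever \<alpha> and \<beta> are; this is why a radius bound free of both suffices.\<close>
  have "\<gamma> * ((\<beta> - \<alpha>) / (\<beta> + \<alpha>)) < \<gamma> * 1"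
    using assms(1,3,4) by (intro mult_strict_left_mono) auto
  moreover have "0 \<le> \<gamma> * (\<beta> + \<alpha>)\<^sup>2"
    using assms(1) by simp
  moreover have "\<gamma> < eta_sq \<rho> n k + d * eta_sq \<rho> n k"
    using radius_bound_imp_eta_sq_bound[OF assms(1,5,13)] by (simp add: algebra_simps)
  ultimately have trace: "(\<gamma> * ((\<beta> - \<alpha>) / (\<beta> + \<alpha>)) - eta_sq \<rho> n k)
      + (- (\<gamma> * (\<beta> + \<alpha>)\<^sup>2) - d * eta_sq \<rho> n k) < 0"
    by linarith
  show ?thesis
    unfolding stability_matrix_eq[OF assms(3,4)]
    using steady real_mat2_negative_trace_instability[OF trace] by blast
qed

end
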